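(* Let $k\ge 1$, $n\ge 1$ be integers and let $c>0$. The function $\mathbf p\mapsto \mathrm P_{\mathbf p}[f_{\mathrm{ecp}}(\mathbf X)\le c]$ is Schur-convex on $\mathcal P_k$. Consequently, $$\mathrm P_{\mathbf p}[f_{\mathrm{ecp}}(\mathbf X)\le c]\ \ge\ \mathrm P_{\mathrm{ecp}}[f_{\mathrm{ecp}}(\mathbf X)\le c]\qquad\text{for all }\mathbf p\in\mathcal P_k .$$
   Context: Let $\mathcal S_{k,n}=\{\mathbf x=(x_1,\dots,x_k): x_j\in\mathbb Z_{\ge 0},\ \sum_{j=1}^k x_j=n\}$ and $\mathcal P_k=\{\mathbf p=(p_1,\dots,p_k): 0\le p_j\le 1,\ \sum_{j=1}^k p_j=1\}$. For $\mathbf p\in\mathcal P_k$, $\mathrm P_{\mathbf p}$ denotes probability when $\mathbf X$ has the multinomial pmf $f_{\mathbf p}(\mathbf x)=\frac{n!}{\prod_{j=1}^k x_j!}\prod_{j=1}^k p_j^{x_j}$ on $\mathcal S_{k,n}$ (with $0^0=1$). Let $\mathbf p_{\mathrm{ecp}}=(1/k,\dots,1/k)$, $f_{\mathrm{ecp}}=f_{\mathbf p_{\mathrm{ecp}}}$, so $f_{\mathrm{ecp}}(\mathbf x)=\frac{n!}{\prod_j x_j!}k^{-n}$, and $\mathrm P_{\mathrm{ecp}}=\mathrm P_{\mathbf p_{\mathrm{ecp}}}$. A vector $\mathbf a\in\mathbb R^k$ majorizes $\mathbf b\in\mathbb R^k$ if $\sum_j a_j=\sum_j b_j$ and, for each $m<k$,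 the sum of the $m$ largest coordinates of $\mathbf a$ is at least that of $\mathbf b$. A function $\phi$ is Schur-convex if $\phi(\mathbf a)\ge\phi(\mathbf b)$ whenever $\mathbf a$ majorizes $\mathbf b$. *)

theory Defs
  imports "HOL-Probability.Probability"
begin

text \<open>Vectors in $k$ coordinates are lists of length \<open>k\<close>; \<open>p ! j\<close> with \<open>j < k\<close> is the
  coordinate $p_{j+1}$.\<close>

definition count_vectors :: "nat \<Rightarrow> nat \<Rightarrow> nat list set" where
  "count_vectors k n = {x. length x = k \<and> sum_list x = n}"

definition prob_vectors :: "nat \<Rightarrow> real list set" where
  "prob_vectors k = {p. length p = k \<and> (\<forall>j<k. 0 \<le> p ! j \<and> p ! j \<le> 1) \<and> sum_list p = 1}"

definition multinomial_mass :: "nat \<Rightarrow> nat \<Rightarrow> real list \<Rightarrow> nat list \<Rightarrow> real" where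
  "multinomial_mass k n p x = fact n / (\<Prod>j<k. fact (x ! j)) * (\<Prod>j<k. (p ! j) ^ (x ! j))"

definition multinomial :: "nat \<Rightarrow> nat \<Rightarrow> real list \<Rightarrow> nat list measure" where
  "multinomial k n p =
     point_measure (count_vectors k n) (\<lambda>x. ennreal (multinomial_mass k n p x))"

definition p_ecp :: "nat \<Rightarrow> real list" where
  "p_ecp k = replicate k (1 / real k)"

definition f_ecp :: "nat \<Rightarrow> nat \<Rightarrow> nat list \<Rightarrow> real" where
  "f_ecp k n = multinomial_mass k n (p_ecp k)"

definition majorizes :: "real list \<Rightarrow> real list \<Rightarrow> bool" where
  "majorizes a b \<longleftrightarrow> length a = length b \<and> sum_list a = sum_list b \<and>
     (\<forall>m<length a. sum_list (take m (rev (sort a))) \<ge> sum_list (take m (rev (sort b))))"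

definition schur_convex_on :: "real list set \<Rightarrow> (real list \<Rightarrow> real) \<Rightarrow> bool" where
  "schur_convex_on D \<phi> \<longleftrightarrow> (\<forall>a\<in>D. \<forall>b\<in>D. majorizes a b \<longrightarrow> \<phi> a \<ge> \<phi> b)"

lemma finite_count_vectors: "finite (count_vectors k n)"
proof (rule finite_subset)
  show "count_vectors k n \<subseteq> {x. set x \<subseteq> {..n} \<and> length x = k}"
    using member_le_sum_list by (fastforce simp: count_vectors_def)
qed (simp add: finite_lists_length_eq)

lemma count_vectors_Suc:
  "count_vectors (Suc k) n = (\<Union>i\<in>{..n}. Cons i ` count_vectors k (n - i))"
proof (intro set_eqI iffI)
  fix x assume "x \<in> count_vectors (Suc k) n"
  then show "x \<in> (\<Union>i\<in>{..n}. Cons i ` count_vectors k (n - i))"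
    by (cases x) (auto simp: count_vectors_def intro!: bexI[of _ "hd x"])
qed (auto simp: count_vectors_def)

lemma multinomial_mass_Cons:
  assumes "i \<le> n"
  shows "multinomial_mass (Suc k) n (a # p) (i # x) =
    real (n choose i) * a ^ i * multinomial_mass k (n - i) p x"
  using assms
  by (simp add: multinomial_mass_def prod.lessThan_Suc_shift binomial_fact field_simps
      del: prod.lessThan_Suc)

lemma sum_multinomial_mass:
  "(\<Sum>x\<in>count_vectors (length p) n. multinomial_mass (length p) n p x) = sum_list p ^ n"
proof (induction p arbitrary: n)
  case Nil
  have "count_vectors 0 n = (if n = 0 then {[]} else {})"
    by (auto simp: count_vectors_def)
  then show ?case by (simp add: multinomial_mass_def)
next
  case (Cons a p)
  let ?k = "length p"
  have "(\<Sum>x\<in>count_vectors (Suc ?k) n. multinomial_mass (Suc ?k) n (a # p) x) =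
      (\<Sum>i\<le>n. \<Sum>x\<in>Cons i ` count_vectors ?k (n - i). multinomial_mass (Suc ?k) n (a # p) x)"
    unfolding count_vectors_Suc
    by (rule sum.UNION_disjoint) (auto simp: finite_count_vectors)
  also have "\<dots> = (\<Sum>i\<le>n. \<Sum>x\<in>count_vectors ?k (n - i).
      real (n choose i) * a ^ i * multinomial_mass ?k (n - i) p x)"
    by (rule sum.cong[OF refl]) (simp add: sum.reindex multinomial_mass_Cons)
  also have "\<dots> = (\<Sum>i\<le>n. real (n choose i) * a ^ i * sum_list p ^ (n - i))"
    by (simp add: sum_distrib_left[symmetric] Cons.IH)
  also have "\<dots> = (a + sum_list p) ^ n"
    by (simp add: binomial_ring)
  finally show ?case by simp
qed

lemma prob_space_multinomial:
  assumes "p \<in> prob_vectors k"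
  shows "prob_space (multinomial k n p)"
proof
  have p: "length p = k" "sum_list p = 1" and nn: "\<And>j. j < k \<Longrightarrow> 0 \<le> p ! j"
    using assms by (auto simp: prob_vectors_def)
  have "0 \<le> multinomial_mass k n p x" for x
    unfolding multinomial_mass_def
    by (intro mult_nonneg_nonneg divide_nonneg_nonneg prod_nonneg) (auto simp: nn)
  then have "(\<Sum>x\<in>count_vectors k n. ennreal (multinomial_mass k n p x)) = 1"
    using sum_multinomial_mass[of p n] p by simp
  then show "emeasure (multinomial k n p) (space (multinomial k n p)) = 1"
    by (simp add: multinomial_def space_point_measure emeasure_point_measure_finite
        finite_count_vectors)
qed

end

(*
  Write \<phi>(p) for the expectation of g(X) under the multinomial law with cell probabilities p,
  where g is symmetric and g(y + e_j) \<le> g(y + e_i) whenever y_j \<le> y_i.  As a polynomial in p,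
  \<phi> has i-th partial derivative n * E[g(Y + e_i)], with Y multinomial of size n - 1.  Pairing y
  with its image under the exchange of coordinates i and j shows that these partial derivatives
  are ordered like the coordinates of p (the Schur-Ostrowski criterion).  Hence, by Abel
  summation, \<phi> is nondecreasing along the segment from sorted b to sorted a when a majorizes b.
  The event f_ecp \<le> c is a lower bound on the product of the x_j!, so its indicator is such a g.
*)
theory Submission
  imports Defs
begin

section \<open>Multinomial probabilities as polynomials in the cell probabilities\<close>

definition multinomial_expectation ::
    "nat \<Rightarrow> nat \<Rightarrow> (nat list \<Rightarrow> real) \<Rightarrow> real list \<Rightarrow> real" where
  "multinomial_expectation k n g p = (\<Sum>x\<in>count_vectors k n. g x * multinomial_mass k n p x)"

lemma multinomial_mass_nonneg:
  assumes "\<And>j. j < k \<Longrightarrow> 0 \<le> p ! j"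
  shows "0 \<le> multinomial_mass k n p x"
  unfolding multinomial_mass_def using assms
  by (intro mult_nonneg_nonneg divide_nonneg_nonneg prod_nonneg) auto

text \<open>This replaces the measure by a finite sum that is polynomial in \<open>p\<close> and
  makes sense for any real list, so that it can be differentiated along a curve.\<close>

lemma prob_multinomial:
  assumes "p \<in> prob_vectors k"
  shows "\<P>(X in multinomial k n p. P X) = multinomial_expectation k n (\<lambda>x. of_bool (P x)) p"
proof -
  have nn: "0 \<le> multinomial_mass k n p x" for x
    using assms by (intro multinomial_mass_nonneg) (auto simp: prob_vectors_def)
  have "emeasure (multinomial k n p) {x \<in> count_vectors k n. P x} =
      (\<Sum>x | x \<in> count_vectors k n \<and> P x. ennreal (multinomial_mass k n p x))"
    unfolding multinomial_def
    by (rule emeasure_point_measure_finite) (auto simp: finite_count_vectors)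
  also have "\<dots> = ennreal (\<Sum>x | x \<in> count_vectors k n \<and> P x. multinomial_mass k n p x)"
    by (rule sum_ennreal) (rule nn)
  also have "(\<Sum>x | x \<in> count_vectors k n \<and> P x. multinomial_mass k n p x) =
      multinomial_expectation k n (\<lambda>x. of_bool (P x)) p"
    unfolding multinomial_expectation_def
    by (rule sum.mono_neutral_cong_left) (auto simp: finite_count_vectors)
  finally have "emeasure (multinomial k n p) {x \<in> count_vectors k n. P x} =
      ennreal (multinomial_expectation k n (\<lambda>x. of_bool (P x)) p)" .
  moreover have "0 \<le> multinomial_expectation k n (\<lambda>x. of_bool (P x)) p"
    unfolding multinomial_expectation_def by (intro sum_nonneg mult_nonneg_nonneg nn) auto
  moreover have "space (multinomial k n p) = count_vectors k n"
    by (simp add: multinomial_def space_point_measure)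
  ultimately show ?thesis
    by (simp add: measure_def)
qed

section \<open>Invariance under permutations of the coordinates\<close>

lemma prod_permute_list:
  assumes "\<pi> permutes {..<k}" "length x = k" "length p = k"
  shows "(\<Prod>j<k. f (permute_list \<pi> p ! j) (permute_list \<pi> x ! j)) = (\<Prod>j<k. f (p ! j) (x ! j))"
proof -
  have "(\<Prod>j<k. f (p ! j) (x ! j)) = (\<Prod>j<k. f (p ! \<pi> j) (x ! \<pi> j))"
    using prod.permute[OF assms(1), of "\<lambda>j. f (p ! j) (x ! j)"] by (simp add: o_def)
  also have "\<dots> = (\<Prod>j<k. f (permute_list \<pi> p ! j) (permute_list \<pi> x ! j))"
    using assms by (intro prod.cong) (auto simp: permute_list_nth)
  finally show ?thesis by simp
qed

lemma multinomial_mass_permute: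
  assumes "\<pi> permutes {..<k}" "length x = k" "length p = k"
  shows "multinomial_mass k n (permute_list \<pi> p) (permute_list \<pi> x) = multinomial_mass k n p x"
  using prod_permute_list[OF assms, of "\<lambda>_ i. fact i :: real"] prod_permute_list[OF assms, of "(^)"]
  by (simp add: multinomial_mass_def)

lemma sum_count_vectors_permute:
  assumes "\<pi> permutes {..<k}"
  shows "(\<Sum>x\<in>count_vectors k n. h (permute_list \<pi> x)) = (\<Sum>x\<in>count_vectors k n. h x)"
proof -
  have inv: "inv \<pi> permutes {..<k}"
    using assms by (rule permutes_inv)
  have sum_list: "sum_list (permute_list \<rho> x) = sum_list x"
    if "\<rho> permutes {..<k}" "length x = k" for \<rho> and x :: "nat list"
    using mset_permute_list[of \<rho> x] that by (metis sum_mset_sum_list)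
  show ?thesis
  proof (rule sum.reindex_bij_witness[of _ "permute_list (inv \<pi>)" "permute_list \<pi>"])
    fix x assume x: "x \<in> count_vectors k n"
    then have len: "length x = k" by (simp add: count_vectors_def)
    show "permute_list (inv \<pi>) (permute_list \<pi> x) = x"
      using permute_list_compose[of "inv \<pi>" x \<pi>] inv len permutes_inv_o[OF assms] by simp
    show "permute_list \<pi> (permute_list (inv \<pi>) x) = x"
      using permute_list_compose[of \<pi> x "inv \<pi>"] assms len permutes_inv_o[OF assms] by simp
    show "permute_list \<pi> x \<in> count_vectors k n" "permute_list (inv \<pi>) x \<in> count_vectors k n"
      using x sum_list[OF assms len] sum_list[OF inv len] by (auto simp: count_vectors_def)
  qed simp
qed

text \<open>Permuting \<open>p\<close> and \<open>x\<close> together leaves the mass unchanged, and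
  the sum over all count vectors absorbs the permutation of \<open>x\<close>. This allows
  \<open>p\<close> to be sorted, as in the definition of majorization.\<close>

lemma multinomial_expectation_cong_mset:
  assumes sym: "\<And>x y. mset x = mset y \<Longrightarrow> g x = g y"
    and "length q = k" "mset p = mset q"
  shows "multinomial_expectation k n g p = multinomial_expectation k n g q"
proof -
  obtain \<pi> where \<pi>: "\<pi> permutes {..<k}" "permute_list \<pi> q = p"
    using mset_eq_permutation[OF assms(3)] assms(2) by metis
  have "multinomial_expectation k n g p =
      (\<Sum>x\<in>count_vectors k n. g (permute_list \<pi> x) * multinomial_mass k n p (permute_list \<pi> x))"
    unfolding multinomial_expectation_def
    by (rule sum_count_vectors_permute[OF \<pi>(1), symmetric])
  also have "\<dots> = multinomial_expectation k n g q"
    unfolding multinomial_expectation_def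
  proof (rule sum.cong[OF refl])
    fix x assume "x \<in> count_vectors k n"
    then have len: "length x = k" by (simp add: count_vectors_def)
    have "g (permute_list \<pi> x) = g x"
      using \<pi>(1) len by (intro sym) simp
    then show "g (permute_list \<pi> x) * multinomial_mass k n p (permute_list \<pi> x) =
        g x * multinomial_mass k n q x"
      using multinomial_mass_permute[OF \<pi>(1) len assms(2)] \<pi>(2) by simp
  qed
  finally show ?thesis .
qed

section \<open>Partial derivatives of the expectation\<close>

lemma prod_list_update:
  assumes "i < k" "length x = k"
  shows "(\<Prod>j<k. f j (x[i := v] ! j)) = f i v * (\<Prod>j\<in>{..<k} - {i}. f j (x ! j))"
proof -
  have "(\<Prod>j<k. f j (x[i := v] ! j)) =
      f i (x[i := v] ! i) * (\<Prod>j\<in>{..<k} - {i}. f j (x[i := v] ! j))"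
    using assms by (intro prod.remove) auto
  also have "(\<Prod>j\<in>{..<k} - {i}. f j (x[i := v] ! j)) = (\<Prod>j\<in>{..<k} - {i}. f j (x ! j))"
    by (intro prod.cong) auto
  finally show ?thesis using assms by simp
qed

text \<open>The left side is the \<open>i\<close>-th partial derivative, taken monomial by monomial.
  The factor \<open>x ! i\<close> cancels against \<open>fact (x ! i)\<close>, which leaves the mass
  of \<open>x\<close> with entry \<open>i\<close> lowered by one; \<open>fact (Suc n)\<close>
  supplies the factor \<open>Suc n\<close>.\<close>

lemma multinomial_mass_partial_derivative:
  assumes "i < k"
  shows "(\<Sum>x\<in>count_vectors k (Suc n). g x * (fact (Suc n) / (\<Prod>j<k. fact (x ! j)) *
      (real (x ! i) * p ! i ^ (x ! i - 1) * (\<Prod>j\<in>{..<k} - {i}. p ! j ^ (x ! j))))) =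
    real (Suc n) * multinomial_expectation k n (\<lambda>y. g (y[i := Suc (y ! i)])) p"
    (is "(\<Sum>x\<in>_. ?F x) = _")
proof -
  \<comment> \<open>Terms with \<open>x ! i = 0\<close> vanish, so the truncated exponent
    \<open>x ! i - 1\<close> does no harm there, and every remaining \<open>x\<close> is an
    incremented count vector of size \<open>n\<close>.\<close>
  have "(\<Sum>x\<in>count_vectors k (Suc n). ?F x) =
      (\<Sum>x | x \<in> count_vectors k (Suc n) \<and> 0 < x ! i. ?F x)"
    by (rule sum.mono_neutral_right) (auto simp: finite_count_vectors)
  also have "\<dots> = (\<Sum>y\<in>count_vectors k n.
      real (Suc n) * (g (y[i := Suc (y ! i)]) * multinomial_mass k n p y))"
  proof (rule sum.reindex_bij_witness[of _ "\<lambda>y. y[i := Suc (y ! i)]" "\<lambda>x. x[i := x ! i - 1]"])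
    fix x assume x: "x \<in> {x \<in> count_vectors k (Suc n). 0 < x ! i}"
    then have len: "length x = k" and sum: "sum_list x = Suc n" and pos: "0 < x ! i"
      by (auto simp: count_vectors_def)
    show "(x[i := x ! i - 1])[i := Suc (x[i := x ! i - 1] ! i)] = x"
      using assms len pos by simp
    show "x[i := x ! i - 1] \<in> count_vectors k n"
      using assms len sum pos by (simp add: count_vectors_def sum_list_update)
    obtain m where m: "x ! i = Suc m" using pos gr0_conv_Suc by blast
    \<comment> \<open>The entry \<open>i\<close> is split off twice, once with the lowered value
      \<open>m\<close> and once with its own value \<open>Suc m\<close>, where the update changes
      nothing.\<close>
    have fact_x: "(\<Prod>j<k. fact (x ! j) :: real) = real (Suc m) * (\<Prod>j<k. fact (x[i := m] ! j))"
      using prod_list_update[OF assms len, of "\<lambda>_ v. fact v :: real" m]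
        prod_list_update[OF assms len, of "\<lambda>_ v. fact v :: real" "Suc m"] m
      by (metis fact_Suc list_update_id mult.assoc)
    have power_x: "(\<Prod>j<k. p ! j ^ (x[i := m] ! j)) =
        p ! i ^ m * (\<Prod>j\<in>{..<k} - {i}. p ! j ^ (x ! j))"
      by (rule prod_list_update[OF assms len])
    have "real (Suc m) \<noteq> 0" by simp
    then show "real (Suc n) * (g ((x[i := x ! i - 1])[i := Suc (x[i := x ! i - 1] ! i)]) *
        multinomial_mass k n p (x[i := x ! i - 1])) = ?F x"
      using assms len m list_update_id[of x i]
      by (simp add: multinomial_mass_def fact_x power_x del: of_nat_Suc)
  next
    fix y assume y: "y \<in> count_vectors k n"
    then show "(y[i := Suc (y ! i)])[i := y[i := Suc (y ! i)] ! i - 1] = y"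
      using assms by (simp add: count_vectors_def)
    show "y[i := Suc (y ! i)] \<in> {x \<in> count_vectors k (Suc n). 0 < x ! i}"
      using assms y by (auto simp: count_vectors_def sum_list_update)
  qed
  finally show ?thesis
    by (simp add: multinomial_expectation_def sum_distrib_left)
qed

text \<open>This is the chain rule along a curve \<open>q\<close> with velocity \<open>d\<close> at
  \<open>t\<close>. The product rule acts on each monomial; exchanging the sums over
  \<open>x\<close> and \<open>i\<close> isolates the coefficient of \<open>d i\<close>, which
  \<open>multinomial_mass_partial_derivative\<close> evaluates.\<close>

lemma DERIV_multinomial_expectation:
  assumes len: "\<And>t. length (q t) = k"
    and q: "\<And>j. j < k \<Longrightarrow> ((\<lambda>t. q t ! j) has_real_derivative d j) (at t)"
  shows "((\<lambda>t. multinomial_expectation k (Suc n) g (q t)) has_real_derivative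
    real (Suc n) * (\<Sum>i<k. d i * multinomial_expectation k n (\<lambda>y. g (y[i := Suc (y ! i)])) (q t)))
    (at t)"
proof -
  let ?C = "\<lambda>x. fact (Suc n) / (\<Prod>j<k. fact (x ! j)) :: real"
  let ?R = "\<lambda>x i. real (x ! i) * q t ! i ^ (x ! i - 1) * (\<Prod>j\<in>{..<k} - {i}. q t ! j ^ (x ! j))"
  have "((\<lambda>t. \<Prod>j<k. q t ! j ^ (x ! j)) has_real_derivative
      (\<Sum>i<k. (real (x ! i) * (d i * q t ! i ^ (x ! i - 1))) *
        (\<Prod>j\<in>{..<k} - {i}. q t ! j ^ (x ! j)))) (at t)" for x
    using DERIV_power[OF q] by (intro has_field_derivative_prod) auto
  then have "((\<lambda>t. multinomial_expectation k (Suc n) g (q t)) has_real_derivative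
      (\<Sum>x\<in>count_vectors k (Suc n). g x * (?C x *
        (\<Sum>i<k. (real (x ! i) * (d i * q t ! i ^ (x ! i - 1))) *
          (\<Prod>j\<in>{..<k} - {i}. q t ! j ^ (x ! j)))))) (at t)"
    unfolding multinomial_expectation_def multinomial_mass_def
    by (intro DERIV_sum DERIV_cmult)
  also have "(\<Sum>x\<in>count_vectors k (Suc n). g x * (?C x *
        (\<Sum>i<k. (real (x ! i) * (d i * q t ! i ^ (x ! i - 1))) *
          (\<Prod>j\<in>{..<k} - {i}. q t ! j ^ (x ! j))))) =
      (\<Sum>x\<in>count_vectors k (Suc n). \<Sum>i<k. d i * (g x * (?C x * ?R x i)))"
    by (simp add: sum_distrib_left mult_ac)
  also have "\<dots> = (\<Sum>i<k. d i * (\<Sum>x\<in>count_vectors k (Suc n). g x * (?C x * ?R x i)))"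
    by (subst sum.swap) (simp add: sum_distrib_left)
  also have "\<dots> = real (Suc n) *
      (\<Sum>i<k. d i * multinomial_expectation k n (\<lambda>y. g (y[i := Suc (y ! i)])) (q t))"
    unfolding sum_distrib_left
    by (rule sum.cong[OF refl])
      (simp only: lessThan_iff multinomial_mass_partial_derivative mult.left_commute
        flip: sum_distrib_left)
  finally show ?thesis .
qed

section \<open>Ordering of the partial derivatives\<close>

lemma power_mult_power_swap_le:
  fixes a b :: real
  assumes "0 \<le> b" "b \<le> a" "l \<le> m"
  shows "a ^ l * b ^ m \<le> a ^ m * b ^ l"
proof -
  \<comment> \<open>With the common factor \<open>a ^ l * b ^ l\<close> taken out, only the powers
    with exponent \<open>m - l\<close> are compared.\<close>
  have "(a ^ l * b ^ l) * b ^ (m - l) \<le> (a ^ l * b ^ l) * a ^ (m - l)"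
    using assms by (intro mult_left_mono power_mono) auto
  moreover have "a ^ m = a ^ l * a ^ (m - l)" "b ^ m = b ^ l * b ^ (m - l)"
    using assms(3) by (simp_all flip: power_add)
  ultimately show ?thesis by (simp add: mult_ac)
qed

text \<open>Swapping two counts keeps the product of factorials, so only the powers at
  \<open>i\<close> and \<open>j\<close> matter, and these favour the larger count at the larger
  probability. Describing \<open>z\<close> by its entries lets a vector and its swapped image take
  either role.\<close>

lemma multinomial_mass_swap_le:
  assumes "i < k" "j < k" "i \<noteq> j" "length y = k" "length z = k"
    and nn: "\<And>l. l < k \<Longrightarrow> 0 \<le> p ! l" and "p ! j \<le> p ! i" "y ! j \<le> y ! i"
    and z: "z ! i = y ! j" "z ! j = y ! i" "\<And>l. l < k \<Longrightarrow> l \<noteq> i \<Longrightarrow> l \<noteq> j \<Longrightarrow> z ! l = y ! l"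
  shows "multinomial_mass k n p z \<le> multinomial_mass k n p y"
proof -
  have split: "(\<Prod>l<k. f l (w ! l)) =
      f i (w ! i) * f j (w ! j) * (\<Prod>l\<in>{..<k} - {i} - {j}. f l (w ! l))"
    for f :: "nat \<Rightarrow> nat \<Rightarrow> real" and w
    using assms(1-3) by (simp add: prod.remove[of "{..<k}" i] prod.remove[of "{..<k} - {i}" j])
  have rest: "(\<Prod>l\<in>{..<k} - {i} - {j}. f l (z ! l)) = (\<Prod>l\<in>{..<k} - {i} - {j}. f l (y ! l))"
    for f :: "nat \<Rightarrow> nat \<Rightarrow> real"
    by (intro prod.cong) (auto simp: z(3))
  have facts: "(\<Prod>l<k. fact (z ! l) :: real) = (\<Prod>l<k. fact (y ! l))"
    using split[of "\<lambda>_. fact" z] split[of "\<lambda>_. fact" y] rest[of "\<lambda>_. fact"] z(1,2) by simp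
  have "p ! i ^ (y ! j) * p ! j ^ (y ! i) \<le> p ! i ^ (y ! i) * p ! j ^ (y ! j)"
    using assms by (intro power_mult_power_swap_le) auto
  moreover have "0 \<le> (\<Prod>l\<in>{..<k} - {i} - {j}. p ! l ^ (y ! l))"
    using nn by (intro prod_nonneg) auto
  ultimately have "(\<Prod>l<k. p ! l ^ (z ! l)) \<le> (\<Prod>l<k. p ! l ^ (y ! l))"
    using split[of "\<lambda>l m. p ! l ^ m" z] split[of "\<lambda>l m. p ! l ^ m" y]
      rest[of "\<lambda>l m. p ! l ^ m"] z(1,2)
    by (simp add: mult_right_mono)
  then show ?thesis
    unfolding multinomial_mass_def facts
    by (intro mult_left_mono divide_nonneg_nonneg prod_nonneg) auto
qed

text \<open>Symmetrization over the swap \<sigma> of \<open>i\<close> and \<open>j\<close> writes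
  twice the difference of the two sides as a sum of products
  \<open>(?u i y - ?u j y) * (?m y - ?m (\<sigma> y))\<close>. Both factors are nonnegative if
  \<open>y ! j \<le> y ! i\<close>, and both are nonpositive otherwise.\<close>

lemma multinomial_expectation_increment_mono:
  assumes sym: "\<And>x y. mset x = mset y \<Longrightarrow> g x = g y"
    and mono: "\<And>y i j. length y = k \<Longrightarrow> i < k \<Longrightarrow> j < k \<Longrightarrow> y ! j \<le> y ! i \<Longrightarrow>
      g (y[j := Suc (y ! j)]) \<le> g (y[i := Suc (y ! i)])"
    and ij: "i < k" "j < k"
    and nn: "\<And>l. l < k \<Longrightarrow> 0 \<le> p ! l" and le: "p ! j \<le> p ! i"
  shows "multinomial_expectation k n (\<lambda>y. g (y[j := Suc (y ! j)])) p \<le>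
    multinomial_expectation k n (\<lambda>y. g (y[i := Suc (y ! i)])) p"
proof (cases "i = j")
  case False
  define \<sigma> :: "nat list \<Rightarrow> nat list" where "\<sigma> = permute_list (Transposition.transpose i j)"
  have perm: "Transposition.transpose i j permutes {..<k}"
    using ij by (intro permutes_swap_id) auto
  let ?m = "multinomial_mass k n p" and ?S = "count_vectors k n"
  let ?u = "\<lambda>i y. g (y[i := Suc (y ! i)])"
  have nth_\<sigma>: "\<sigma> y ! l = y ! Transposition.transpose i j l" if "length y = k" "l < k" for y l
    using that perm by (simp add: \<sigma>_def permute_list_nth)
  have len_\<sigma>: "length (\<sigma> y) = length y" for y by (simp add: \<sigma>_def)
  have \<sigma>_update: "(\<sigma> y)[i := Suc (\<sigma> y ! i)] = \<sigma> (y[j := Suc (y ! j)])"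
      "(\<sigma> y)[j := Suc (\<sigma> y ! j)] = \<sigma> (y[i := Suc (y ! i)])" if "length y = k" for y
    using that ij
    by (auto intro!: nth_equalityI simp: len_\<sigma> nth_\<sigma> nth_list_update Transposition.transpose_def)
  have g_\<sigma>: "g (\<sigma> x) = g x" if "length x = k" for x
    unfolding \<sigma>_def using that perm by (intro sym mset_permute_list) simp
  \<comment> \<open>Reindexing by \<sigma> moves the increment to the other coordinate and the swap
    onto the mass, because \<open>g\<close> is invariant under \<sigma>.\<close>
  have shift: "(\<Sum>y\<in>?S. ?u a y * ?m y) = (\<Sum>y\<in>?S. ?u b y * ?m (\<sigma> y))"
    if "(a, b) = (i, j) \<or> (a, b) = (j, i)" for a b
  proof -
    have "(\<Sum>y\<in>?S. ?u a y * ?m y) = (\<Sum>y\<in>?S. ?u a (\<sigma> y) * ?m (\<sigma> y))"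
      unfolding \<sigma>_def by (rule sum_count_vectors_permute[OF perm, symmetric])
    also have "\<dots> = (\<Sum>y\<in>?S. ?u b y * ?m (\<sigma> y))"
      using that by (intro sum.cong) (auto simp: count_vectors_def \<sigma>_update g_\<sigma>)
    finally show ?thesis .
  qed
  have "0 \<le> (?u i y - ?u j y) * (?m y - ?m (\<sigma> y))" if "y \<in> ?S" for y
  proof -
    have len: "length y = k" using that by (simp add: count_vectors_def)
    have z: "\<sigma> y ! i = y ! j" "\<sigma> y ! j = y ! i"
        "\<And>l. l < k \<Longrightarrow> l \<noteq> i \<Longrightarrow> l \<noteq> j \<Longrightarrow> \<sigma> y ! l = y ! l"
      using ij len by (simp_all add: nth_\<sigma>)
    show ?thesis
    proof (cases "y ! j \<le> y ! i")
      case True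
      then have "?m (\<sigma> y) \<le> ?m y"
        using ij \<open>i \<noteq> j\<close> len nn le z by (intro multinomial_mass_swap_le[of i k j]) (auto simp: len_\<sigma>)
      with mono[OF len ij True] show ?thesis by simp
    next
      case F: False
      then have "?m y \<le> ?m (\<sigma> y)"
        using ij \<open>i \<noteq> j\<close> len nn le z by (intro multinomial_mass_swap_le[of i k j]) (auto simp: len_\<sigma>)
      with mono[OF len ij(2,1)] F show ?thesis by (simp add: mult_nonpos_nonpos)
    qed
  qed
  then have "0 \<le> (\<Sum>y\<in>?S. (?u i y - ?u j y) * (?m y - ?m (\<sigma> y)))"
    by (rule sum_nonneg)
  \<comment> \<open>By \<open>shift\<close>, the second bracket equals the first; hence the factor 2
    below.\<close>
  also have "\<dots> = ((\<Sum>y\<in>?S. ?u i y * ?m y) - (\<Sum>y\<in>?S. ?u j y * ?m y)) +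
      ((\<Sum>y\<in>?S. ?u j y * ?m (\<sigma> y)) - (\<Sum>y\<in>?S. ?u i y * ?m (\<sigma> y)))"
    by (simp add: sum.distrib sum_subtractf algebra_simps)
  also have "\<dots> = 2 * ((\<Sum>y\<in>?S. ?u i y * ?m y) - (\<Sum>y\<in>?S. ?u j y * ?m y))"
    using shift[of i j] shift[of j i] by simp
  finally show ?thesis
    by (simp add: multinomial_expectation_def)
qed simp

section \<open>Abel summation and monotonicity along a segment\<close>

lemma sum_mult_decreasing_ge:
  fixes d D :: "nat \<Rightarrow> real"
  assumes "\<And>m. m \<le> n \<Longrightarrow> 0 \<le> (\<Sum>i<m. d i)"
    and "\<And>i. i < n \<Longrightarrow> D (Suc i) \<le> D i"
  shows "(\<Sum>i<Suc n. d i) * D n \<le> (\<Sum>i<Suc n. d i * D i)"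
  using assms
proof (induction n)
  case (Suc n)
  \<comment> \<open>One step of Abel summation: the partial sum is nonnegative, so passing from the
    weight \<open>D n\<close> to the smaller \<open>D (Suc n)\<close> can only lower the
    product.\<close>
  have "(\<Sum>i<Suc n. d i) * D (Suc n) \<le> (\<Sum>i<Suc n. d i) * D n"
    using Suc.prems(1)[of "Suc n"] Suc.prems(2)[of n] by (intro mult_left_mono) auto
  also have "\<dots> \<le> (\<Sum>i<Suc n. d i * D i)"
    using Suc.prems by (intro Suc.IH) auto
  finally show ?case by (simp add: algebra_simps)
qed simp

lemma sum_list_take_eq_sum:
  "m \<le> length xs \<Longrightarrow> sum_list (take m xs) = (\<Sum>i<m. xs ! i)"
  by (simp add: sum_list_sum_nth atLeast0LessThan min_absorb2)

lemma rev_sort_nth_mono: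
  "i \<le> j \<Longrightarrow> j < length a \<Longrightarrow> rev (sort a) ! j \<le> rev (sort a) ! i"
  by (simp add: rev_nth sorted_nth_mono)

lemma sum_list_sort: "sum_list (sort a) = sum_list (a :: real list)"
proof -
  have "sum_list (sort a) = \<Sum>\<^sub># (mset (sort a))"
    by (rule sum_mset_sum_list[symmetric])
  also have "\<dots> = sum_list a" by (simp add: sum_mset_sum_list)
  finally show ?thesis .
qed

text \<open>When both endpoints are decreasing, so is every point of the segment between them. The
  partial derivatives therefore keep one and the same order along it, and Abel summation against the
  velocity \<open>a - b\<close> gives a nonnegative derivative.\<close>

lemma multinomial_expectation_mono_sorted:
  assumes sym: "\<And>x y. mset x = mset y \<Longrightarrow> g x = g y"
    and mono: "\<And>y i j. length y = k \<Longrightarrow> i < k \<Longrightarrow> j < k \<Longrightarrow> y ! j \<le> y ! i \<Longrightarrow>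
      g (y[j := Suc (y ! j)]) \<le> g (y[i := Suc (y ! i)])"
    and len: "length a = k" "length b = k"
    and nn: "\<And>j. j < k \<Longrightarrow> 0 \<le> a ! j" "\<And>j. j < k \<Longrightarrow> 0 \<le> b ! j"
    and decr: "\<And>i. Suc i < k \<Longrightarrow> a ! Suc i \<le> a ! i" "\<And>i. Suc i < k \<Longrightarrow> b ! Suc i \<le> b ! i"
    and partial: "\<And>m. m < k \<Longrightarrow> (\<Sum>i<m. b ! i) \<le> (\<Sum>i<m. a ! i)"
    and total: "(\<Sum>i<k. a ! i) = (\<Sum>i<k. b ! i)"
  shows "multinomial_expectation k (Suc n) g b \<le> multinomial_expectation k (Suc n) g a"
proof -
  define d where "d j = a ! j - b ! j" for j
  define q where "q t = map (\<lambda>j. b ! j + t * d j) [0..<k]" for t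
  have q_nth: "q t ! j = b ! j + t * d j" if "j < k" for t j
    using that by (simp add: q_def)
  \<comment> \<open>In this form the points with \<open>t\<close> between 0 and 1 visibly inherit
    nonnegativity and the decreasing order; \<open>q_nth\<close> is the form used for the
    derivative.\<close>
  have q_convex: "q t ! j = (1 - t) * b ! j + t * a ! j" if "j < k" for t j
    using that by (simp add: q_nth d_def algebra_simps)
  let ?\<phi> = "\<lambda>t. multinomial_expectation k (Suc n) g (q t)"
  have "?\<phi> 0 \<le> ?\<phi> 1"
  proof (rule DERIV_nonneg_imp_nondecreasing[where f = "?\<phi>"])
    fix t :: real assume t: "0 \<le> t" "t \<le> 1"
    let ?D = "\<lambda>i. multinomial_expectation k n (\<lambda>y. g (y[i := Suc (y ! i)])) (q t)"
    have deriv: "(?\<phi> has_real_derivative real (Suc n) * (\<Sum>i<k. d i * ?D i)) (at t)"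
    proof (rule DERIV_multinomial_expectation)
      show "((\<lambda>t. q t ! j) has_real_derivative d j) (at t)" if "j < k" for j
        using that by (auto simp: q_nth intro!: derivative_eq_intros)
    qed (simp add: q_def)
    have "0 \<le> (\<Sum>i<k. d i * ?D i)"
    proof (cases k)
      case (Suc k')
      have "?D (Suc i) \<le> ?D i" if "i < k'" for i
      proof (rule multinomial_expectation_increment_mono[where g = g, OF sym mono])
        show "0 \<le> q t ! l" if "l < k" for l
          using that nn t by (simp add: q_convex)
        show "q t ! Suc i \<le> q t ! i"
          using that Suc decr t by (simp add: q_convex add_mono mult_left_mono)
      qed (use that Suc in auto)
      \<comment> \<open>The range \<open>m \<le> k'\<close> is \<open>m < k\<close>, as in
        majorization. The full sum of \<open>d\<close> is zero by \<open>total\<close>, so the lower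
        bound from Abel summation is 0 whatever the sign of \<open>?D k'\<close>.\<close>
      moreover have "0 \<le> (\<Sum>i<m. d i)" if "m \<le> k'" for m
        using partial[of m] that Suc by (simp add: d_def sum_subtractf)
      ultimately have "(\<Sum>i<Suc k'. d i) * ?D k' \<le> (\<Sum>i<Suc k'. d i * ?D i)"
        by (intro sum_mult_decreasing_ge)
      moreover have "(\<Sum>i<Suc k'. d i) = 0"
        using total Suc by (simp add: d_def sum_subtractf)
      ultimately show ?thesis using Suc by simp
    qed simp
    then have "0 \<le> real (Suc n) * (\<Sum>i<k. d i * ?D i)"
      by (rule mult_nonneg_nonneg[OF of_nat_0_le_iff])
    with deriv show "\<exists>y. (?\<phi> has_real_derivative y) (at t) \<and> 0 \<le> y"
      by blast
  qed simp
  moreover have "q 0 = b" "q 1 = a"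
    using len by (auto intro!: nth_equalityI simp: q_def d_def)
  ultimately show ?thesis by simp
qed

text \<open>Symmetry of \<open>g\<close> allows both vectors to be replaced by their decreasing
  rearrangements, whose partial sums majorization compares. The size is \<open>Suc n\<close> because
  differentiation lowers it by one.\<close>

lemma schur_convex_on_multinomial_expectation:
  assumes sym: "\<And>x y. mset x = mset y \<Longrightarrow> g x = g y"
    and mono: "\<And>y i j. length y = k \<Longrightarrow> i < k \<Longrightarrow> j < k \<Longrightarrow> y ! j \<le> y ! i \<Longrightarrow>
      g (y[j := Suc (y ! j)]) \<le> g (y[i := Suc (y ! i)])"
  shows "schur_convex_on (prob_vectors k) (multinomial_expectation k (Suc n) g)"
  unfolding schur_convex_on_def
proof (intro ballI impI)
  fix a b assume ab: "a \<in> prob_vectors k" "b \<in> prob_vectors k" and maj: "majorizes a b"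
  have len: "length a = k" "length b = k"
    using ab by (auto simp: prob_vectors_def)
  have nn: "0 \<le> rev (sort c) ! j" if "c \<in> prob_vectors k" "j < k" for c j
  proof -
    have "length c = k" using that by (simp add: prob_vectors_def)
    then have "rev (sort c) ! j \<in> set c"
      using that nth_mem[of j "rev (sort c)"] by simp
    then show ?thesis using that by (auto simp: prob_vectors_def in_set_conv_nth)
  qed
  have total: "(\<Sum>i<k. rev (sort c) ! i) = 1" if "c \<in> prob_vectors k" for c
  proof -
    show ?thesis
      using that sum_list_take_eq_sum[of k "rev (sort c)"]
      by (simp add: prob_vectors_def sum_list_sort)
  qed
  have "multinomial_expectation k (Suc n) g (rev (sort b)) \<le>
      multinomial_expectation k (Suc n) g (rev (sort a))"
  proof (rule multinomial_expectation_mono_sorted[where g = g, OF sym mono])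
    show "(\<Sum>i<m. rev (sort b) ! i) \<le> (\<Sum>i<m. rev (sort a) ! i)" if "m < k" for m
      using maj that len by (simp add: majorizes_def flip: sum_list_take_eq_sum)
  qed (use ab len nn total in \<open>auto intro: rev_sort_nth_mono\<close>)
  then show "multinomial_expectation k (Suc n) g b \<le> multinomial_expectation k (Suc n) g a"
    using len multinomial_expectation_cong_mset[where g = g and p = a and k = k and q = "rev (sort a)", OF sym]
      multinomial_expectation_cong_mset[where g = g and p = b and k = k and q = "rev (sort b)", OF sym] by simp
qed

section \<open>The uniform vector and the event \<open>f_ecp k n X \<le> c\<close>\<close>

lemma p_ecp_in_prob_vectors: "1 \<le> k \<Longrightarrow> p_ecp k \<in> prob_vectors k"
  by (auto simp: prob_vectors_def p_ecp_def sum_list_replicate)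

text \<open>The mean of the \<open>m\<close> largest coordinates is at least the mean
  \<open>1 / k\<close> of all of them.\<close>

lemma majorizes_p_ecp:
  assumes "p \<in> prob_vectors k"
  shows "majorizes p (p_ecp k)"
proof -
  have len: "length p = k" and sum: "sum_list p = 1"
    using assms by (auto simp: prob_vectors_def)
  have "k \<noteq> 0" using len sum by auto
  have "real m / real k \<le> sum_list (take m (rev (sort p)))" if m: "m < k" for m
  proof -
    define r where "r = rev (sort p)"
    have r: "length r = k" "sum_list r = 1"
      using len sum by (simp_all add: r_def sum_list_sort)
    \<comment> \<open>The entry \<open>r ! m\<close> serves as pivot: it bounds the first
      \<open>m\<close> entries from below and all entries from index \<open>m\<close> on from
      above.\<close>
    have "(\<Sum>i<m. r ! m) \<le> (\<Sum>i<m. r ! i)"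
      unfolding r_def using m len by (intro sum_mono rev_sort_nth_mono) auto
    then have head: "real m * r ! m \<le> (\<Sum>i<m. r ! i)" by simp
    have "(\<Sum>i=m..<k. r ! i) \<le> (\<Sum>i=m..<k. r ! m)"
      unfolding r_def using len by (intro sum_mono rev_sort_nth_mono) auto
    then have tail: "(\<Sum>i=m..<k. r ! i) \<le> (real k - real m) * r ! m"
      using m by (simp add: of_nat_diff)
    have "(\<Sum>i<k. r ! i) = (\<Sum>i<m. r ! i) + (\<Sum>i=m..<k. r ! i)"
      using sum.atLeastLessThan_concat[of 0 m k "(!) r"] m by (simp add: atLeast0LessThan)
    then have "1 - (\<Sum>i<m. r ! i) \<le> (real k - real m) * r ! m"
      using tail r sum_list_take_eq_sum[of k r] by simp
    \<comment> \<open>Scaling the tail bound by \<open>m\<close> produces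
      \<open>real m * r ! m\<close>, so that \<open>head\<close> can eliminate the pivot.\<close>
    then have "real m * (1 - (\<Sum>i<m. r ! i)) \<le> (real k - real m) * (real m * r ! m)"
      by (metis mult.left_commute mult_left_mono of_nat_0_le_iff)
    also have "\<dots> \<le> (real k - real m) * (\<Sum>i<m. r ! i)"
      using head m by (intro mult_left_mono) auto
    finally have "real m \<le> real k * (\<Sum>i<m. r ! i)"
      by (simp add: algebra_simps)
    then show ?thesis
      using \<open>k \<noteq> 0\<close> m r sum_list_take_eq_sum[of m r]
      by (simp add: r_def field_simps)
  qed
  then show ?thesis
    using len sum \<open>k \<noteq> 0\<close>
    by (simp add: majorizes_def p_ecp_def sum_list_replicate sort_replicate min_absorb1)
qed

text \<open>Equal cell probabilities merge into a single power with exponent \<open>n\<close>, so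
  the value varies with \<open>x\<close> only through the factorials.\<close>

lemma f_ecp_eq:
  assumes "x \<in> count_vectors k n"
  shows "f_ecp k n x = fact n / (\<Prod>j<k. fact (x ! j)) * (1 / real k) ^ n"
proof -
  have "(\<Prod>j<k. p_ecp k ! j ^ (x ! j)) = (1 / real k) ^ (\<Sum>j<k. x ! j)"
    by (simp add: p_ecp_def power_sum)
  also have "(\<Sum>j<k. x ! j) = n"
    using assms by (auto simp: count_vectors_def sum_list_sum_nth atLeast0LessThan)
  finally show ?thesis by (simp add: f_ecp_def multinomial_mass_def)
qed

text \<open>Raising entry \<open>m\<close> by one multiplies the product of factorials by
  \<open>Suc (y ! m)\<close>, which is larger for the larger entry.\<close>

lemma prod_fact_increment_mono:
  assumes "length y = k" "i < k" "j < k" "y ! j \<le> y ! i"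
  shows "(\<Prod>l<k. fact (y[j := Suc (y ! j)] ! l) :: real) \<le>
    (\<Prod>l<k. fact (y[i := Suc (y ! i)] ! l))"
proof -
  have "(\<Prod>l<k. fact (y[m := Suc (y ! m)] ! l) :: real) =
      real (Suc (y ! m)) * (\<Prod>l<k. fact (y ! l))" if "m < k" for m
    using prod_list_update[OF that assms(1), of "\<lambda>_ v. fact v :: real" "Suc (y ! m)"]
      prod_list_update[OF that assms(1), of "\<lambda>_ v. fact v :: real" "y ! m"]
    by (simp add: mult.assoc)
  then show ?thesis
    using assms by (simp add: mult_right_mono prod_nonneg)
qed

theorem proposition4p1:
  fixes k n :: nat and c :: real
  assumes "k \<ge> 1" and "n \<ge> 1" and "c > 0"
  shows "schur_convex_on (prob_vectors k) (\<lambda>p. \<P>(X in multinomial k n p. f_ecp k n X \<le> c)) \<and>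
    (\<forall>p\<in>prob_vectors k.
       \<P>(X in multinomial k n p. f_ecp k n X \<le> c) \<ge>
       \<P>(X in multinomial k n (p_ecp k). f_ecp k n X \<le> c))"
proof -
  obtain n' where n': "n = Suc n'"
    using assms(2) by (cases n) auto
  \<comment> \<open>This is the indicator of the event with the denominator cleared. Symmetry is
    required for lists of every length, whereas \<open>f_ecp\<close> reads only the first
    \<open>k\<close> entries; \<open>prod_list\<close> depends on the multiset alone.\<close>
  define g :: "nat list \<Rightarrow> real" where
    "g x = of_bool (fact n * (1 / real k) ^ n \<le> c * prod_list (map fact x))" for x
  have prod_list_fact: "prod_list (map fact x) = (\<Prod>j<k. fact (x ! j) :: real)"
    if "length x = k" for x
    using that by (simp add: prod.list_conv_set_nth atLeast0LessThan)
  have g_sym: "g x = g y" if "mset x = mset y" for x y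
  proof -
    have "prod_list (map fact x) = (prod_list (map fact y) :: real)"
      using that by (metis mset_map prod_mset_prod_list)
    then show ?thesis by (simp add: g_def)
  qed
  have g_mono: "g (y[j := Suc (y ! j)]) \<le> g (y[i := Suc (y ! i)])"
    if "length y = k" "i < k" "j < k" "y ! j \<le> y ! i" for y i j
  proof -
    \<comment> \<open>Since \<open>c\<close> is positive, the order of the factorial products
      survives scaling, and the indicator is nondecreasing in the scaled product.\<close>
    have "c * prod_list (map fact (y[j := Suc (y ! j)])) \<le>
        c * prod_list (map fact (y[i := Suc (y ! i)]))"
      using prod_fact_increment_mono[OF that] assms(3) that(1)
      by (simp only: prod_list_fact length_list_update mult_left_mono less_imp_le)
    then show ?thesis
      using order_trans by (fastforce simp only: g_def of_bool_def split: if_splits)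
  qed
  have prob: "\<P>(X in multinomial k n p. f_ecp k n X \<le> c) = multinomial_expectation k n g p"
    if "p \<in> prob_vectors k" for p
    unfolding prob_multinomial[OF that] multinomial_expectation_def
  proof (rule sum.cong[OF refl])
    fix x assume x: "x \<in> count_vectors k n"
    have "0 < (\<Prod>j<k. fact (x ! j) :: real)" by (simp add: prod_pos)
    then have "f_ecp k n x \<le> c \<longleftrightarrow> fact n * (1 / real k) ^ n \<le> c * (\<Prod>j<k. fact (x ! j))"
      unfolding f_ecp_eq[OF x] times_divide_eq_left by (rule pos_divide_le_eq)
    then show "of_bool (f_ecp k n x \<le> c) * multinomial_mass k n p x =
        g x * multinomial_mass k n p x"
      using x by (simp add: g_def prod_list_fact count_vectors_def)
  qed
  have schur: "schur_convex_on (prob_vectors k) (\<lambda>p. \<P>(X in multinomial k n p. f_ecp k n X \<le> c))"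
    using schur_convex_on_multinomial_expectation[where g = g and k = k and n = n', OF g_sym g_mono] prob
    by (simp add: schur_convex_on_def n')
  then show ?thesis
    using majorizes_p_ecp p_ecp_in_prob_vectors[OF assms(1)]
    by (auto simp: schur_convex_on_def)
qed

end
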